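(* Let $\Delta$ be a pure two-dimensional simplicial complex. (i) If $I_\Delta^{(m)}=I_\Delta^m$ for some $m\ge 3$, then $I_\Delta^{(k)}=I_\Delta^k$ for all $1\le k\le m$. (ii) If $I_\Delta^{(m)}=I_\Delta^m$ for some $m\ge 4$, then $I_\Delta^{(t)}=I_\Delta^t$ for all $t\ge 1$.
   Context: Let $K$ be a field and $R=K[x_1,\dots,x_n]$. A simplicial complex $\Delta$ on the vertex set $[n]=\{1,\dots,n\}$ is assumed to satisfy $\{i\}\in\Delta$ for every $i\in[n]$. A facet is a maximal face; $\mathcal F(\Delta)$ is the set of facets; $\Delta$ is pure if all facets have the same dimension. The Stanley-Reisner ideal is $I_\Delta=(x_{i_1}\cdots x_{i_s} : \{i_1,\dots,i_s\}\notin\Delta)$. The $m$-th symbolic power is $I_\Delta^{(m)}=\bigcap_{F\in\mathcal F(\Delta)}P_F^m$, where $P_F=(x_i : i\notin F)$. *)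

theory Defs
  imports "HOL-Library.Poly_Mapping" "HOL-Algebra.Ideal_Product"
begin

type_synonym 'k mpoly = "(nat \<Rightarrow>\<^sub>0 nat) \<Rightarrow>\<^sub>0 'k"

text \<open>
  The type \<open>'k mpoly\<close> has one variable for every natural number; \<open>K[x_1,...,x_n]\<close> is the subring
  of the polynomials in which only the variables with index in \<open>{1..n}\<close> occur.
\<close>

definition poly_ring :: "nat \<Rightarrow> 'k::comm_ring_1 mpoly ring" where
  "poly_ring n = \<lparr>carrier = {p. \<forall>m\<in>Poly_Mapping.keys p. Poly_Mapping.keys m \<subseteq> {1..n}},
     mult = (*), one = 1, zero = 0, add = (+)\<rparr>"

definition pvar :: "nat \<Rightarrow> 'k::comm_ring_1 mpoly" where
  "pvar i = Poly_Mapping.single (Poly_Mapping.single i 1) 1"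

definition simplicial_complex :: "nat \<Rightarrow> nat set set \<Rightarrow> bool" where
  "simplicial_complex n \<Delta> \<longleftrightarrow>
     \<Delta> \<subseteq> Pow {1..n} \<and> (\<forall>F\<in>\<Delta>. \<forall>G\<subseteq>F. G \<in> \<Delta>) \<and> (\<forall>i\<in>{1..n}. {i} \<in> \<Delta>)"

definition facets :: "nat set set \<Rightarrow> nat set set" where
  "facets \<Delta> = {F \<in> \<Delta>. \<forall>G\<in>\<Delta>. F \<subseteq> G \<longrightarrow> G = F}"

definition face_dim :: "nat set \<Rightarrow> int" where
  "face_dim F = int (card F) - 1"

definition complex_dim :: "nat set set \<Rightarrow> int" where
  "complex_dim \<Delta> = Max (face_dim ` \<Delta>)"

definition pure_complex :: "nat set set \<Rightarrow> bool" where
  "pure_complex \<Delta> \<longleftrightarrow> (\<forall>F\<in>facets \<Delta>. \<forall>G\<in>facets \<Delta>. face_dim F = face_dim G)"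

definition stanley_reisner_ideal :: "nat \<Rightarrow> nat set set \<Rightarrow> 'k::comm_ring_1 mpoly set" where
  "stanley_reisner_ideal n \<Delta> =
     genideal (poly_ring n) {\<Prod>i\<in>S. pvar i |S. S \<subseteq> {1..n} \<and> S \<notin> \<Delta>}"

definition facet_prime :: "nat \<Rightarrow> nat set \<Rightarrow> 'k::comm_ring_1 mpoly set" where
  "facet_prime n F = genideal (poly_ring n) (pvar ` ({1..n} - F))"

definition ideal_power :: "nat \<Rightarrow> 'k::comm_ring_1 mpoly set \<Rightarrow> nat \<Rightarrow> 'k mpoly set" where
  "ideal_power n I m = I [^]\<^bsub>ideals_set (poly_ring n)\<^esub> m"

definition symbolic_power :: "nat \<Rightarrow> nat set set \<Rightarrow> nat \<Rightarrow> 'k::comm_ring_1 mpoly set" where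
  "symbolic_power n \<Delta> m = (\<Inter>F\<in>facets \<Delta>. ideal_power n (facet_prime n F) m)"

lemma keys_uminus_mpoly: "Poly_Mapping.keys (- p) = Poly_Mapping.keys (p :: 'k::comm_ring_1 mpoly)"
  by (simp add: keys.rep_eq)

lemma cring_poly_ring: "cring (poly_ring n :: 'k::comm_ring_1 mpoly ring)"
proof (rule cringI)
  show "abelian_group (poly_ring n :: 'k mpoly ring)"
  proof (rule abelian_groupI)
    fix p q :: "'k mpoly"
    assume "p \<in> carrier (poly_ring n)" "q \<in> carrier (poly_ring n)"
    then show "p \<oplus>\<^bsub>poly_ring n\<^esub> q \<in> carrier (poly_ring n)"
      using Poly_Mapping.keys_add[of p q] by (fastforce simp: poly_ring_def)
  next
    fix p :: "'k mpoly"
    assume "p \<in> carrier (poly_ring n)"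
    then show "\<exists>q\<in>carrier (poly_ring n). q \<oplus>\<^bsub>poly_ring n\<^esub> p = \<zero>\<^bsub>poly_ring n\<^esub>"
      by (intro bexI[of _ "- p"]) (auto simp: poly_ring_def keys_uminus_mpoly)
  qed (auto simp: poly_ring_def algebra_simps)
  show "comm_monoid (poly_ring n :: 'k mpoly ring)"
  proof (rule comm_monoidI)
    fix p q :: "'k mpoly"
    assume p: "p \<in> carrier (poly_ring n)" and q: "q \<in> carrier (poly_ring n)"
    have "Poly_Mapping.keys m \<subseteq> {1..n}" if "m \<in> Poly_Mapping.keys (p * q)" for m
    proof -
      obtain a b where "m = a + b" "a \<in> Poly_Mapping.keys p" "b \<in> Poly_Mapping.keys q"
        using Poly_Mapping.keys_mult[of p q] \<open>m \<in> Poly_Mapping.keys (p * q)\<close> by auto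
      then show ?thesis
        using p q Poly_Mapping.keys_add[of a b] by (fastforce simp: poly_ring_def)
    qed
    then show "p \<otimes>\<^bsub>poly_ring n\<^esub> q \<in> carrier (poly_ring n)"
      by (simp add: poly_ring_def)
  qed (auto simp: poly_ring_def algebra_simps)
qed (auto simp: poly_ring_def algebra_simps)

end

theory Submission
  imports Defs "HOL-Library.Multiset"
begin

text \<open>
  For \<open>a \<in> \<nat>\<^sup>n\<close>, the monomial \<open>x\<^sup>a\<close> lies in the \<open>m\<close>-th symbolic power iff \<open>a\<close> has weight at least
  \<open>m\<close> outside every facet (\<open>a\<close> is \<^emph>\<open>thick\<close>), and in the \<open>m\<close>-th ordinary power iff \<open>m\<close> nonfaces, with
  repetition, can be packed into \<open>a\<close>.  Adding copies of a nonface \<open>N\<close> of least cardinality \<open>s\<close> to the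
  indicator of a set \<open>W\<close> raises the thickness by at least one and the size by \<open>s\<close> per copy, so equality at \<open>m\<close>
  forces \<open>r * s \<le> |W|\<close> whenever \<open>W\<close> has thickness \<open>r \<le> m\<close>.  Hence there are no three pairwise
  non-adjacent vertices, and \<open>n \<le> 6\<close> if \<open>m \<ge> 4\<close>.  If \<open>n \<le> 6\<close>, equality at some \<open>m \<ge> 3\<close> yields
  \<open>n - 3\<close> disjoint nonfaces.  By counting, each of them has exactly one vertex outside any given facet,
  so it can be split off from any exponent containing it; this reduces equality for all powers to exponents
  supported on at most three vertices.  There remains the passage from \<open>m = 3\<close> to \<open>2\<close> for \<open>n \<ge> 7\<close>:
  an exponent containing a non-adjacent pair \<open>e\<close> is enlarged by \<open>e\<close>, and one of the three nonfaces
  packed into the result is discarded.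
\<close>

section \<open>Monomial ideals\<close>

abbreviation divides_exp :: "(nat \<Rightarrow>\<^sub>0 nat) \<Rightarrow> (nat \<Rightarrow>\<^sub>0 nat) \<Rightarrow> bool" where
  "divides_exp a u \<equiv> (\<forall>i. Poly_Mapping.lookup a i \<le> Poly_Mapping.lookup u i)"

text \<open>Described through supports instead of generators, so that membership is tested one
  monomial at a time; \<open>genideal_monomials\<close> identifies it with a generated ideal when
  \<open>A\<close> lies in \<open>exponents n\<close>.\<close>

definition monomial_ideal :: "nat \<Rightarrow> (nat \<Rightarrow>\<^sub>0 nat) set \<Rightarrow> 'k::comm_ring_1 mpoly set" where
  "monomial_ideal n A =
     {p \<in> carrier (poly_ring n). \<forall>u\<in>Poly_Mapping.keys p. \<exists>a\<in>A. divides_exp a u}"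

definition exponents :: "nat \<Rightarrow> (nat \<Rightarrow>\<^sub>0 nat) set" where
  "exponents n = {u. Poly_Mapping.keys u \<subseteq> {1..n}}"

lemma carrier_poly_ring: "p \<in> carrier (poly_ring n) \<longleftrightarrow> Poly_Mapping.keys p \<subseteq> exponents n"
  by (auto simp: poly_ring_def exponents_def)

lemma poly_ring_simps [simp]:
  "x \<otimes>\<^bsub>poly_ring n\<^esub> y = x * y" "x \<oplus>\<^bsub>poly_ring n\<^esub> y = x + y"
  "\<one>\<^bsub>poly_ring n\<^esub> = 1" "\<zero>\<^bsub>poly_ring n\<^esub> = 0"
  by (simp_all add: poly_ring_def)

lemma ring_poly_ring: "ring (poly_ring n :: 'k::comm_ring_1 mpoly ring)"
  by (rule cring.axioms(1)) (rule cring_poly_ring)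

lemma exponents_add:
  "a \<in> exponents n \<Longrightarrow> b \<in> exponents n \<Longrightarrow> a + b \<in> exponents n"
  using Poly_Mapping.keys_add[of a b] by (auto simp: exponents_def)

lemma exponents_minus:
  "a \<in> exponents n \<Longrightarrow> a - b \<in> exponents n"
  by (auto simp: exponents_def in_keys_iff lookup_minus)

lemma divides_exp_eq: "divides_exp a u \<Longrightarrow> u = a + (u - a)"
  by (rule poly_mapping_eqI) (simp add: lookup_add lookup_minus)

lemma a_inv_poly_ring:
  fixes p :: "'k::comm_ring_1 mpoly"
  assumes "p \<in> carrier (poly_ring n)"
  shows "inv\<^bsub>add_monoid (poly_ring n)\<^esub> p = - p"
proof -
  interpret R: ring "poly_ring n :: 'k mpoly ring" by (rule ring_poly_ring)
  have "- p \<in> carrier (poly_ring n)"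
    using assms by (simp add: carrier_poly_ring keys_uminus_mpoly)
  then have "\<ominus>\<^bsub>poly_ring n\<^esub> p = - p"
    using assms by (intro R.minus_equality) auto
  then show ?thesis by (simp add: a_inv_def)
qed

lemma ideal_monomial_ideal: "ideal (monomial_ideal n A) (poly_ring n :: 'k::comm_ring_1 mpoly ring)"
proof (rule idealI)
  interpret R: cring "poly_ring n :: 'k mpoly ring" by (rule cring_poly_ring)
  show "ring (poly_ring n :: 'k mpoly ring)" by (rule ring_poly_ring)
  let ?I = "monomial_ideal n A :: 'k mpoly set"
  have add: "p + q \<in> ?I" if "p \<in> ?I" "q \<in> ?I" for p q
  proof -
    have "p + q \<in> carrier (poly_ring n)"
      using R.add.m_closed[of p q] that by (simp add: monomial_ideal_def)
    then show ?thesis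
      using that Poly_Mapping.keys_add[of p q] unfolding monomial_ideal_def by blast
  qed
  have mult: "p * q \<in> ?I" if p: "p \<in> ?I" and q: "q \<in> carrier (poly_ring n)" for p q
  proof -
    have "\<exists>a\<in>A. divides_exp a u" if u: "u \<in> Poly_Mapping.keys (p * q)" for u
    proof -
      obtain v w where vw: "u = v + w" "v \<in> Poly_Mapping.keys p"
        using Poly_Mapping.keys_mult[of p q] u by blast
      then obtain a where "a \<in> A" "divides_exp a v" using p by (auto simp: monomial_ideal_def)
      then show ?thesis unfolding vw(1) by (auto simp: lookup_add intro!: bexI[of _ a] trans_le_add1)
    qed
    moreover have "p * q \<in> carrier (poly_ring n)"
      using R.m_closed[of p q] p q by (simp add: monomial_ideal_def)
    ultimately show ?thesis by (simp add: monomial_ideal_def)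
  qed
  show "subgroup ?I (add_monoid (poly_ring n))"
  proof (rule subgroup.intro)
    show "?I \<subseteq> carrier (add_monoid (poly_ring n))" by (auto simp: monomial_ideal_def)
  next
    fix p assume p: "p \<in> ?I"
    then have "inv\<^bsub>add_monoid (poly_ring n)\<^esub> p = - p"
      by (intro a_inv_poly_ring) (simp add: monomial_ideal_def)
    moreover have "- p \<in> ?I"
      using p by (simp add: monomial_ideal_def carrier_poly_ring keys_uminus_mpoly)
    ultimately show "inv\<^bsub>add_monoid (poly_ring n)\<^esub> p \<in> ?I" by (simp only:)
  next
    show "\<one>\<^bsub>add_monoid (poly_ring n)\<^esub> \<in> ?I"
      using R.zero_closed by (simp add: monomial_ideal_def)
  qed (simp add: add)
  show "x \<otimes>\<^bsub>poly_ring n\<^esub> a \<in> ?I" if "a \<in> ?I" "x \<in> carrier (poly_ring n)" for a x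
    using mult[OF that] by (simp add: mult.commute)
  show "a \<otimes>\<^bsub>poly_ring n\<^esub> x \<in> ?I" if "a \<in> ?I" "x \<in> carrier (poly_ring n)" for a x
    using mult[OF that] by simp
qed

lemma sum_monomials:
  "p = (\<Sum>u\<in>Poly_Mapping.keys p. Poly_Mapping.single u (Poly_Mapping.lookup p u))"
proof (rule poly_mapping_eqI)
  fix k
  have "(\<Sum>u\<in>Poly_Mapping.keys p. Poly_Mapping.lookup (Poly_Mapping.single u (Poly_Mapping.lookup p u)) k)
      = (\<Sum>u\<in>Poly_Mapping.keys p. if u = k then Poly_Mapping.lookup p u else 0)"
    by (intro sum.cong) (auto simp: lookup_single)
  then show "Poly_Mapping.lookup p k = Poly_Mapping.lookup
      (\<Sum>u\<in>Poly_Mapping.keys p. Poly_Mapping.single u (Poly_Mapping.lookup p u)) k"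
    by (simp add: lookup_sum in_keys_iff)
qed

text \<open>Every term of \<open>p\<close> is a multiple of a monomial with exponent in
  \<open>A\<close>, hence lies in \<open>J\<close>, and \<open>p\<close> is the finite sum of its
  terms. This supplies one inclusion both for generated ideals and for products.\<close>

lemma monomial_ideal_subset:
  fixes J :: "'k::comm_ring_1 mpoly set"
  assumes J: "ideal J (poly_ring n)" and A: "\<And>a. a \<in> A \<Longrightarrow> Poly_Mapping.single a 1 \<in> J"
  shows "monomial_ideal n A \<subseteq> J"
proof
  interpret J: ideal J "poly_ring n" by (rule J)
  note J_zero = additive_subgroup.zero_closed[OF ideal.axioms(1)[OF J]]
    and J_add = additive_subgroup.a_closed[OF ideal.axioms(1)[OF J]]
  fix p :: "'k mpoly" assume p: "p \<in> monomial_ideal n A"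
  have mon: "Poly_Mapping.single u c \<in> J" if u: "u \<in> Poly_Mapping.keys p" for u and c :: 'k
  proof -
    obtain a where a: "a \<in> A" "divides_exp a u"
      using p u by (auto simp: monomial_ideal_def)
    have "u - a \<in> exponents n"
      using p u by (auto simp: monomial_ideal_def carrier_poly_ring intro!: exponents_minus)
    then have "Poly_Mapping.single (u - a) c \<in> carrier (poly_ring n)"
      by (auto simp: carrier_poly_ring)
    \<comment> \<open>The coefficient \<open>c\<close> goes into the cofactor, so \<open>J\<close>
      needs to contain the generators with coefficient 1 only.\<close>
    then have "Poly_Mapping.single a 1 * Poly_Mapping.single (u - a) c \<in> J"
      using J.I_r_closed[OF A[OF a(1)]] by simp
    then show ?thesis
      using divides_exp_eq[OF a(2)] by (simp add: mult_single)
  qed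
  have "(\<Sum>u\<in>U. Poly_Mapping.single u (Poly_Mapping.lookup p u)) \<in> J"
    if "finite U" "U \<subseteq> Poly_Mapping.keys p" for U
    using that
  proof (induction U)
    case empty
    show ?case using J_zero by simp
  next
    case (insert u U)
    then show ?case using J_add[OF mon[of u "Poly_Mapping.lookup p u"]] by simp
  qed
  from this[of "Poly_Mapping.keys p"] show "p \<in> J"
    using sum_monomials[of p] by simp
qed

lemma single_in_monomial_ideal:
  fixes c :: "'k::comm_ring_1"
  shows "u \<in> exponents n \<Longrightarrow> a \<in> A \<Longrightarrow> divides_exp a u \<Longrightarrow> Poly_Mapping.single u c \<in> monomial_ideal n A"
  by (auto simp: monomial_ideal_def carrier_poly_ring)

lemma genideal_monomials:
  assumes "A \<subseteq> exponents n"
  shows "genideal (poly_ring n) ((\<lambda>a. Poly_Mapping.single a (1::'k::comm_ring_1)) ` A) = monomial_ideal n A"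
proof (rule antisym)
  interpret R: ring "poly_ring n :: 'k mpoly ring" by (rule ring_poly_ring)
  let ?S = "(\<lambda>a. Poly_Mapping.single a (1::'k)) ` A"
  have sub: "?S \<subseteq> monomial_ideal n A"
    using assms by (auto intro: single_in_monomial_ideal)
  then show "genideal (poly_ring n) ?S \<subseteq> monomial_ideal n A"
    by (rule R.genideal_minimal[OF ideal_monomial_ideal])
  have S: "?S \<subseteq> carrier (poly_ring n)" using sub by (auto simp: monomial_ideal_def)
  then show "monomial_ideal n A \<subseteq> genideal (poly_ring n) ?S"
    using R.genideal_self[OF S] by (intro monomial_ideal_subset R.genideal_ideal) auto
qed

text \<open>An exponent occurring in a product is a sum of exponents of the factors, hence divisible
  by some \<open>a + b\<close>; conversely each monomial with exponent \<open>a + b\<close> is a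
  product of two generators.\<close>

lemma ideal_prod_monomial_ideals:
  assumes "A \<subseteq> exponents n" "B \<subseteq> exponents n"
  shows "ideal_prod (poly_ring n) (monomial_ideal n A) (monomial_ideal n B) =
    (monomial_ideal n {a + b |a b. a \<in> A \<and> b \<in> B} :: 'k::comm_ring_1 mpoly set)" (is "?P = monomial_ideal n ?C")
proof (rule antisym)
  interpret R: ring "poly_ring n :: 'k mpoly ring" by (rule ring_poly_ring)
  note C_add = additive_subgroup.a_closed[OF ideal.axioms(1)[OF ideal_monomial_ideal], of _ n ?C]
  have "p \<in> monomial_ideal n ?C" if "p \<in> ?P" for p
    using that
  proof induction
    case (prod p q)
    have "\<exists>c\<in>?C. divides_exp c u" if u: "u \<in> Poly_Mapping.keys (p * q)" for u
    proof -
      obtain v w where vw: "u = v + w" "v \<in> Poly_Mapping.keys p" "w \<in> Poly_Mapping.keys q"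
        using Poly_Mapping.keys_mult[of p q] u by blast
      then obtain a b where "a \<in> A" "b \<in> B" "divides_exp a v" "divides_exp b w"
        using prod unfolding monomial_ideal_def by blast
      then show ?thesis
        using vw(1) by (intro bexI[of _ "a + b"]) (auto simp: lookup_add intro: add_mono)
    qed
    moreover have "p * q \<in> carrier (poly_ring n)"
      using R.m_closed[of p q] prod by (simp add: monomial_ideal_def)
    ultimately show ?case by (simp add: monomial_ideal_def)
  next
    case (sum p q)
    then show ?case using C_add by simp
  qed
  then show "?P \<subseteq> monomial_ideal n ?C" by blast
  show "monomial_ideal n ?C \<subseteq> ?P"
  proof (rule monomial_ideal_subset)
    show "ideal ?P (poly_ring n)"
      by (intro R.ideal_prod_is_ideal ideal_monomial_ideal)
    fix c assume "c \<in> ?C"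
    then obtain a b where c: "c = a + b" "a \<in> A" "b \<in> B" by auto
    have "Poly_Mapping.single a 1 \<otimes>\<^bsub>poly_ring n\<^esub> Poly_Mapping.single b 1 \<in> ?P"
      using c assms by (intro ideal_prod.prod single_in_monomial_ideal[of _ _ a] single_in_monomial_ideal[of _ _ b]) auto
    then show "Poly_Mapping.single c 1 \<in> ?P"
      by (simp add: c mult_single)
  qed
qed

section \<open>Powers of monomial ideals\<close>

text \<open>Multisets appear because a generator may be repeated in a product; on exponents,
  products of generators become sums.\<close>

definition multiples :: "'a::comm_monoid_add set \<Rightarrow> nat \<Rightarrow> 'a set" where
  "multiples A m = {\<Sum>\<^sub># M |M. set_mset M \<subseteq> A \<and> size M = m}"

lemma multiples_Suc: "multiples A (Suc m) = {s + a |s a. s \<in> multiples A m \<and> a \<in> A}" (is "_ = ?S")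
proof (intro antisym subsetI)
  fix x assume "x \<in> multiples A (Suc m)"
  then obtain M where M: "set_mset M \<subseteq> A" "size M = Suc m" "x = \<Sum>\<^sub># M"
    by (auto simp: multiples_def)
  then obtain a N where "M = add_mset a N" by (metis size_eq_Suc_imp_eq_union)
  then have "\<Sum>\<^sub># N \<in> multiples A m" "a \<in> A" "x = \<Sum>\<^sub># N + a"
    using M by (auto simp: multiples_def add.commute)
  then show "x \<in> ?S" by blast
next
  fix x assume "x \<in> ?S"
  then obtain M a where M: "set_mset M \<subseteq> A" "size M = m" "a \<in> A" "x = \<Sum>\<^sub># M + a"
    by (auto simp: multiples_def)
  then show "x \<in> multiples A (Suc m)"
    unfolding multiples_def by (auto intro!: exI[of _ "add_mset a M"] simp: add.commute)
qed

lemma multiples_exponents: "A \<subseteq> exponents n \<Longrightarrow> multiples A m \<subseteq> exponents n"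
proof (induction m)
  case 0
  then show ?case by (auto simp: multiples_def exponents_def)
next
  case (Suc m)
  then show ?case by (fastforce simp: multiples_Suc intro: exponents_add)
qed

lemma ideal_power_monomial_ideal:
  assumes "A \<subseteq> exponents n"
  shows "ideal_power n (monomial_ideal n A :: 'k::comm_ring_1 mpoly set) m = monomial_ideal n (multiples A m)"
proof (induction m)
  case 0
  \<comment> \<open>The zeroth power is the whole ring, and the empty sum 0 divides every
    exponent.\<close>
  show ?case by (auto simp: ideal_power_def ideals_set_def monomial_ideal_def multiples_def)
next
  case (Suc m)
  have "ideal_power n (monomial_ideal n A :: 'k mpoly set) (Suc m) =
      ideal_prod (poly_ring n) (ideal_power n (monomial_ideal n A) m) (monomial_ideal n A)"
    by (simp add: ideal_power_def ideals_set_def)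
  also have "\<dots> = monomial_ideal n (multiples A (Suc m))"
    unfolding Suc.IH by (simp add: ideal_prod_monomial_ideals multiples_exponents assms multiples_Suc)
  finally show ?case .
qed

section \<open>Generators of the Stanley-Reisner ideal and of the facet primes\<close>

definition indicator_exp :: "nat set \<Rightarrow> (nat \<Rightarrow>\<^sub>0 nat)" where
  "indicator_exp S = (\<Sum>i\<in>S. Poly_Mapping.single i 1)"

lemma lookup_indicator_exp:
  "finite S \<Longrightarrow> Poly_Mapping.lookup (indicator_exp S) i = of_bool (i \<in> S)"
  by (simp add: indicator_exp_def lookup_sum lookup_single when_def)

lemma indicator_exp_exponents: "S \<subseteq> {1..n} \<Longrightarrow> indicator_exp S \<in> exponents n"
  using finite_subset[of S "{1..n}"] by (auto simp: exponents_def in_keys_iff lookup_indicator_exp)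

lemma prod_pvar:
  "finite S \<Longrightarrow> (\<Prod>i\<in>S. pvar i) = Poly_Mapping.single (indicator_exp S) (1::'k::comm_ring_1)"
  by (induction rule: finite_induct) (simp_all add: indicator_exp_def pvar_def mult_single)

lemma stanley_reisner_ideal_monomial:
  "(stanley_reisner_ideal n \<Delta> :: 'k::comm_ring_1 mpoly set) =
     monomial_ideal n (indicator_exp ` (Pow {1..n} - \<Delta>))"
proof -
  have "{\<Prod>i\<in>S. pvar i |S. S \<subseteq> {1..n} \<and> S \<notin> \<Delta>} =
      (\<lambda>a. Poly_Mapping.single a (1::'k)) ` indicator_exp ` (Pow {1..n} - \<Delta>)"
    using finite_subset[of _ "{1..n}"] by (auto simp: image_iff prod_pvar) (metis prod_pvar)+
  then show ?thesis
    unfolding stanley_reisner_ideal_def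
    by (simp add: genideal_monomials indicator_exp_exponents image_subset_iff)
qed

lemma facet_prime_monomial:
  "(facet_prime n F :: 'k::comm_ring_1 mpoly set) =
     monomial_ideal n ((\<lambda>i. Poly_Mapping.single i 1) ` ({1..n} - F))"
proof -
  have "pvar ` ({1..n} - F) =
      (\<lambda>a. Poly_Mapping.single a (1::'k)) ` (\<lambda>i. Poly_Mapping.single i 1) ` ({1..n} - F)"
    by (simp add: image_image pvar_def)
  then show ?thesis
    unfolding facet_prime_def
    by (simp add: genideal_monomials image_subset_iff exponents_def)
qed

text \<open>In a power of an ideal generated by variables only the degree in these variables
  matters: splitting off a variable with positive exponent lowers that degree by exactly
  one.\<close>

lemma multiples_variables_iff:
  assumes "finite X"
  shows "(\<exists>a\<in>multiples ((\<lambda>i. Poly_Mapping.single i 1) ` X) m. divides_exp a u) \<longleftrightarrow>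
    m \<le> (\<Sum>i\<in>X. Poly_Mapping.lookup u i)"
proof (induction m arbitrary: u)
  case 0
  show ?case by (auto simp: multiples_def)
next
  case (Suc m)
  let ?G = "(\<lambda>i. Poly_Mapping.single i (1::nat)) ` X"
  have eq: "(\<Sum>i\<in>X. Poly_Mapping.lookup (v + Poly_Mapping.single j 1) i) = Suc (\<Sum>i\<in>X. Poly_Mapping.lookup v i)"
    if "j \<in> X" for j v
    using that assms by (simp add: lookup_add sum.distrib lookup_single when_def)
  show ?case
  proof
    assume "\<exists>a\<in>multiples ?G (Suc m). divides_exp a u"
    then obtain s j where sj: "s \<in> multiples ?G m" "j \<in> X" "divides_exp (s + Poly_Mapping.single j 1) u"
      by (auto simp: multiples_Suc)
    have "Suc m \<le> Suc (\<Sum>i\<in>X. Poly_Mapping.lookup s i)"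
      using Suc.IH[of s] sj(1) by auto
    also have "\<dots> \<le> (\<Sum>i\<in>X. Poly_Mapping.lookup u i)"
      unfolding eq[OF sj(2), symmetric] using sj(3) by (intro sum_mono) auto
    finally show "Suc m \<le> (\<Sum>i\<in>X. Poly_Mapping.lookup u i)" .
  next
    assume m: "Suc m \<le> (\<Sum>i\<in>X. Poly_Mapping.lookup u i)"
    then obtain j where j: "j \<in> X" "Poly_Mapping.lookup u j > 0"
      by (metis gr_zeroI not_less_eq_eq sum.neutral zero_le)
    let ?v = "u - Poly_Mapping.single j 1"
    have u: "u = ?v + Poly_Mapping.single j 1"
      using j by (intro poly_mapping_eqI) (auto simp: lookup_add lookup_minus lookup_single when_def)
    have "m \<le> (\<Sum>i\<in>X. Poly_Mapping.lookup ?v i)"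
      using m eq[OF j(1), of ?v] u by simp
    then obtain a where a: "a \<in> multiples ?G m" "divides_exp a ?v"
      using Suc.IH[of ?v] by auto
    have "divides_exp (a + Poly_Mapping.single j 1) u"
      using a(2) by (subst u) (simp add: lookup_add)
    moreover have "a + Poly_Mapping.single j 1 \<in> multiples ?G (Suc m)"
      using a(1) j(1) by (auto simp: multiples_Suc)
    ultimately show "\<exists>a\<in>multiples ?G (Suc m). divides_exp a u" by blast
  qed
qed

section \<open>Packings of nonfaces\<close>

text \<open>For finite members this is the exponent vector of the product of their squarefree
  monomials; see \<open>lookup_sum_indicator_exp\<close>.\<close>

definition load :: "'a set multiset \<Rightarrow> 'a \<Rightarrow> nat" where
  "load Ns i = size {#N \<in># Ns. i \<in> N#}"

lemma load_simps [simp]: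
  "load {#} i = 0" "load (add_mset N Ns) i = of_bool (i \<in> N) + load Ns i"
  by (simp_all add: load_def)

lemma load_eq_0_iff: "load Ns i = 0 \<longleftrightarrow> (\<forall>N\<in>#Ns. i \<notin> N)"
  by (induction Ns) auto

definition packs :: "'a set set \<Rightarrow> 'a set \<Rightarrow> ('a \<Rightarrow> nat) \<Rightarrow> nat \<Rightarrow> bool" where
  "packs \<Delta> V a m \<longleftrightarrow> (\<exists>Ns. set_mset Ns \<subseteq> Pow V - \<Delta> \<and> size Ns = m \<and> (\<forall>i\<in>V. load Ns i \<le> a i))"

definition thick :: "'a set set \<Rightarrow> 'a set \<Rightarrow> ('a \<Rightarrow> nat) \<Rightarrow> nat \<Rightarrow> bool" where
  "thick \<F> V a m \<longleftrightarrow> (\<forall>F\<in>\<F>. m \<le> (\<Sum>i\<in>V - F. a i))"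

lemma lookup_sum_indicator_exp:
  assumes "\<And>N. N \<in># Ns \<Longrightarrow> finite N"
  shows "Poly_Mapping.lookup (\<Sum>N\<in>#Ns. indicator_exp N) i = load Ns i"
  using assms by (induction Ns) (auto simp: lookup_add lookup_indicator_exp)

lemma multiples_nonfaces_iff:
  "(\<exists>a\<in>multiples (indicator_exp ` (Pow {1..n} - \<Delta>)) m. divides_exp a u) \<longleftrightarrow>
    packs \<Delta> {1..n} (Poly_Mapping.lookup u) m"
proof
  assume "\<exists>a\<in>multiples (indicator_exp ` (Pow {1..n} - \<Delta>)) m. divides_exp a u"
  then obtain M where M: "set_mset M \<subseteq> indicator_exp ` (Pow {1..n} - \<Delta>)" "size M = m" "divides_exp (\<Sum>\<^sub># M) u"
    by (auto simp: multiples_def)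
  then obtain Ns where Ns: "set_mset Ns \<subseteq> Pow {1..n} - \<Delta>" "M = image_mset indicator_exp Ns"
  proof -
    \<comment> \<open>A nonface is chosen for each entry of \<open>M\<close> separately, by
      induction on the multiset.\<close>
    have "\<exists>Ns. set_mset Ns \<subseteq> Pow {1..n} - \<Delta> \<and> M = image_mset indicator_exp Ns"
      using M(1)
    proof (induction M)
      case empty
      then show ?case by auto
    next
      case (add x M)
      then obtain Ns N where "set_mset Ns \<subseteq> Pow {1..n} - \<Delta>" "M = image_mset indicator_exp Ns"
        "N \<in> Pow {1..n} - \<Delta>" "x = indicator_exp N" by auto
      then show ?case by (intro exI[of _ "add_mset N Ns"]) auto
    qed
    then show ?thesis using that by blast
  qed
  have "finite N" if "N \<in># Ns" for N
    using that Ns(1) finite_subset[of N "{1..n}"] by auto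
  then have "load Ns i \<le> Poly_Mapping.lookup u i" for i
    using M(3) lookup_sum_indicator_exp[of Ns i] unfolding Ns(2) by metis
  then show "packs \<Delta> {1..n} (Poly_Mapping.lookup u) m"
    using Ns M(2) by (auto simp: packs_def)
next
  assume "packs \<Delta> {1..n} (Poly_Mapping.lookup u) m"
  then obtain Ns where Ns: "set_mset Ns \<subseteq> Pow {1..n} - \<Delta>" "size Ns = m"
    "\<And>i. i \<in> {1..n} \<Longrightarrow> load Ns i \<le> Poly_Mapping.lookup u i"
    by (auto simp: packs_def)
  have fin: "finite N" if "N \<in># Ns" for N
    using that Ns(1) finite_subset[of N "{1..n}"] by auto
  have "load Ns i \<le> Poly_Mapping.lookup u i" for i
  proof (cases "i \<in> {1..n}")
    \<comment> \<open>All members of \<open>Ns\<close> lie in \<open>{1..n}\<close>, so a bound on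
      the loads there is a bound everywhere.\<close>
    case False
    then have "load Ns i = 0" using Ns(1) unfolding load_eq_0_iff by blast
    then show ?thesis by simp
  qed (rule Ns(3))
  then have "divides_exp (\<Sum>N\<in>#Ns. indicator_exp N) u"
    by (simp add: lookup_sum_indicator_exp fin)
  moreover have "(\<Sum>N\<in>#Ns. indicator_exp N) \<in> multiples (indicator_exp ` (Pow {1..n} - \<Delta>)) m"
    unfolding multiples_def using image_mono[OF Ns(1), of indicator_exp] Ns(2)
    by (intro CollectI exI[of _ "image_mset indicator_exp Ns"]) simp
  ultimately show "\<exists>a\<in>multiples (indicator_exp ` (Pow {1..n} - \<Delta>)) m. divides_exp a u" by blast
qed

lemma ideal_power_stanley_reisner:
  "ideal_power n (stanley_reisner_ideal n \<Delta>) m =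
     {p \<in> carrier (poly_ring n :: 'k::comm_ring_1 mpoly ring).
        \<forall>u\<in>Poly_Mapping.keys p. packs \<Delta> {1..n} (Poly_Mapping.lookup u) m}"
proof -
  have "indicator_exp ` (Pow {1..n} - \<Delta>) \<subseteq> exponents n"
    using indicator_exp_exponents by auto
  then show ?thesis
    by (simp add: stanley_reisner_ideal_monomial ideal_power_monomial_ideal del: One_nat_def)
      (simp add: monomial_ideal_def multiples_nonfaces_iff del: One_nat_def)
qed

text \<open>Each power of a facet prime is a degree condition outside the facet, by
  \<open>multiples_variables_iff\<close>. Without facets the intersection would be
  \<open>UNIV\<close>, which is larger than the carrier.\<close>

lemma symbolic_power_eq:
  assumes "facets \<Delta> \<noteq> {}"
  shows "symbolic_power n \<Delta> m =
     {p \<in> carrier (poly_ring n :: 'k::comm_ring_1 mpoly ring).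
        \<forall>u\<in>Poly_Mapping.keys p. thick (facets \<Delta>) {1..n} (Poly_Mapping.lookup u) m}"
proof -
  have "ideal_power n (facet_prime n F) m =
     {p \<in> carrier (poly_ring n :: 'k mpoly ring).
        \<forall>u\<in>Poly_Mapping.keys p. m \<le> (\<Sum>i\<in>{1..n} - F. Poly_Mapping.lookup u i)}" for F
  proof -
    have "(\<lambda>i. Poly_Mapping.single i 1) ` ({1..n} - F) \<subseteq> exponents n"
      by (auto simp: exponents_def)
    then show ?thesis
      by (simp add: facet_prime_monomial ideal_power_monomial_ideal)
        (simp add: monomial_ideal_def multiples_variables_iff[simplified])
  qed
  then show ?thesis using assms by (auto simp: symbolic_power_def thick_def)
qed

text \<open>Only the inclusion of the symbolic in the ordinary power is recorded; for a simplicial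
  complex the reverse one follows from \<open>packs_imp_thick\<close>.\<close>

definition thick_packs :: "nat set set \<Rightarrow> nat set \<Rightarrow> nat \<Rightarrow> bool" where
  "thick_packs \<Delta> V m \<longleftrightarrow> (\<forall>a. thick (facets \<Delta>) V a m \<longrightarrow> packs \<Delta> V a m)"

text \<open>Every packed nonface has a vertex outside \<open>F\<close>, so together they put a load
  of at least \<open>m\<close> on \<open>V - F\<close>.\<close>

lemma packs_imp_thick:
  assumes "finite V" "packs \<Delta> V a m" "\<And>F N. F \<in> \<F> \<Longrightarrow> N \<subseteq> V \<Longrightarrow> N \<notin> \<Delta> \<Longrightarrow> \<not> N \<subseteq> F"
  shows "thick \<F> V a m"
  unfolding thick_def
proof
  fix F assume F: "F \<in> \<F>"
  have "size Ns \<le> (\<Sum>i\<in>V - F. load Ns i)" if "set_mset Ns \<subseteq> Pow V - \<Delta>" for Ns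
    using that
  proof (induction Ns)
    case (add N Ns)
    then have "N \<subseteq> V" "N \<notin> \<Delta>" "size Ns \<le> (\<Sum>i\<in>V - F. load Ns i)" by auto
    then obtain j where j: "j \<in> N" "j \<in> V - F" using assms(3)[OF F, of N] by blast
    then have "1 \<le> (\<Sum>i\<in>V - F. of_bool (i \<in> N) :: nat)"
      using \<open>finite V\<close> member_le_sum[OF j(2), of "\<lambda>i. of_bool (i \<in> N) :: nat"] by simp
    then show ?case
      using \<open>size Ns \<le> _\<close> by (simp add: sum.distrib del: sum_of_bool_eq)
  qed simp
  moreover obtain Ns where Ns: "set_mset Ns \<subseteq> Pow V - \<Delta>" "size Ns = m" "\<forall>i\<in>V. load Ns i \<le> a i"
    using assms(2) by (auto simp: packs_def)
  ultimately have "m \<le> (\<Sum>i\<in>V - F. load Ns i)" by blast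
  also have "\<dots> \<le> (\<Sum>i\<in>V - F. a i)" using Ns(3) by (intro sum_mono) auto
  finally show "m \<le> (\<Sum>i\<in>V - F. a i)" .
qed

lemma thick_cong: "(\<And>i. i \<in> V \<Longrightarrow> a i = b i) \<Longrightarrow> thick \<F> V a m = thick \<F> V b m"
  unfolding thick_def by (intro ball_cong refl arg_cong[where f = "(\<le>) m"] sum.cong) blast+

lemma packs_cong: "(\<And>i. i \<in> V \<Longrightarrow> a i = b i) \<Longrightarrow> packs \<Delta> V a m = packs \<Delta> V b m"
  by (simp add: packs_def)

text \<open>Both sets are determined by the monomials they contain, so a thick exponent is tested by
  a single monomial with coefficient 1, and the field drops out.\<close>

lemma symbolic_eq_ordinary_iff:
  assumes sc: "simplicial_complex n \<Delta>" and ne: "facets \<Delta> \<noteq> {}"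
  shows "(symbolic_power n \<Delta> m :: 'k::field mpoly set) = ideal_power n (stanley_reisner_ideal n \<Delta>) m
    \<longleftrightarrow> thick_packs \<Delta> {1..n} m"
proof
  assume eq: "(symbolic_power n \<Delta> m :: 'k mpoly set) = ideal_power n (stanley_reisner_ideal n \<Delta>) m"
  show "thick_packs \<Delta> {1..n} m"
    unfolding thick_packs_def
  proof (intro allI impI)
    fix a :: "nat \<Rightarrow> nat" assume a: "thick (facets \<Delta>) {1..n} a m"
    \<comment> \<open>The function \<open>a\<close> is arbitrary outside \<open>{1..n}\<close>; it
      is cut off there to give an exponent of the ring.\<close>
    define u where "u = (\<Sum>i\<in>{1..n}. Poly_Mapping.single i (a i))"
    have u: "Poly_Mapping.lookup u i = (if i \<in> {1..n} then a i else 0)" for i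
    proof -
      have "Poly_Mapping.lookup u i = (\<Sum>j\<in>{1..n}. if j = i then a j else 0)"
        unfolding u_def lookup_sum lookup_single when_def ..
      then show ?thesis by (simp only: sum.delta finite_atLeastAtMost)
    qed
    have "i \<in> {1..n}" if "i \<in> Poly_Mapping.keys u" for i
      using that u[of i] unfolding in_keys_iff by presburger
    then have u_exp: "u \<in> exponents n" unfolding exponents_def by blast
    have ua: "Poly_Mapping.lookup u i = a i" if "i \<in> {1..n}" for i
      using u[of i] that by (simp only: if_True)
    have "thick (facets \<Delta>) {1..n} (Poly_Mapping.lookup u) m"
      using a thick_cong[of "{1..n}" "Poly_Mapping.lookup u" a, OF ua] by (simp only:)
    then have "Poly_Mapping.single u (1::'k) \<in> symbolic_power n \<Delta> m"
      using u_exp unfolding symbolic_power_eq[OF ne] carrier_poly_ring by simp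
    then have "packs \<Delta> {1..n} (Poly_Mapping.lookup u) m"
      unfolding eq ideal_power_stanley_reisner by simp
    then show "packs \<Delta> {1..n} a m"
      using packs_cong[of "{1..n}" "Poly_Mapping.lookup u" a, OF ua] by (simp only:)
  qed
next
  assume tp: "thick_packs \<Delta> {1..n} m"
  have "\<not> N \<subseteq> F" if "F \<in> facets \<Delta>" "N \<notin> \<Delta>" for F N
    using that sc unfolding facets_def simplicial_complex_def by blast
  then have "thick (facets \<Delta>) {1..n} a m \<longleftrightarrow> packs \<Delta> {1..n} a m" for a
    using tp packs_imp_thick[of "{1..n}" \<Delta> a m "facets \<Delta>"] unfolding thick_packs_def by blast
  then show "(symbolic_power n \<Delta> m :: 'k mpoly set) = ideal_power n (stanley_reisner_ideal n \<Delta>) m"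
    unfolding symbolic_power_eq[OF ne] ideal_power_stanley_reisner by (simp only:)
qed

section \<open>Counting incidences in packings\<close>

lemma load_plus: "load (M + N) i = load M i + load N i"
  by (simp add: load_def)

lemma load_replicate_mset: "load (replicate_mset k N) i = k * of_bool (i \<in> N)"
  by (induction k) auto

lemma sum_load: "finite X \<Longrightarrow> (\<Sum>i\<in>X. load Ns i) = (\<Sum>N\<in>#Ns. card (N \<inter> X))"
  by (induction Ns) (auto simp: sum.distrib Int_def conj_commute)

lemma size_mult_le_sum_mset:
  "(\<And>N. N \<in># Ns \<Longrightarrow> s \<le> f N) \<Longrightarrow> size Ns * s \<le> (\<Sum>N\<in>#Ns. f N :: nat)"
  by (induction Ns) (auto simp: add_mono)

text \<open>The remaining entries already contribute at least their number, which leaves at most 1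
  for \<open>N\<close>.\<close>

lemma sum_mset_tight:
  assumes "\<And>N. N \<in># Ns \<Longrightarrow> 1 \<le> f N" "(\<Sum>N\<in>#Ns. f N :: nat) \<le> size Ns" "N \<in># Ns"
  shows "f N = 1"
proof -
  obtain Ms where Ms: "Ns = add_mset N Ms" using assms(3) by (metis insert_DiffM)
  have "size Ms * 1 \<le> (\<Sum>N\<in>#Ms. f N)"
    by (rule size_mult_le_sum_mset) (use assms(1) Ms in auto)
  then show ?thesis using assms(1)[of N] assms(2) Ms by auto
qed

lemma card_le_load:
  assumes "T \<subseteq> set_mset Ns" "\<And>N. N \<in> T \<Longrightarrow> i \<in> N"
  shows "card T \<le> load Ns i"
proof -
  have "card (set_mset M) \<le> size M" for M :: "'a set multiset"
    by (induction M) (auto simp: card_insert_if)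
  moreover have "T \<subseteq> set_mset {#N \<in># Ns. i \<in> N#}" using assms by auto
  ultimately show ?thesis
    unfolding load_def by (meson card_mono finite_set_mset order_trans)
qed

section \<open>Two-dimensional complexes\<close>

text \<open>Purity and dimension two enter through \<open>card_facet\<close>;
  \<open>facets_nonempty\<close> excludes the empty family.\<close>

locale two_dim_complex =
  fixes V :: "nat set" and \<Delta> :: "nat set set"
  assumes finite_V: "finite V"
    and faces_subset: "\<Delta> \<subseteq> Pow V"
    and face_subset: "F \<in> \<Delta> \<Longrightarrow> G \<subseteq> F \<Longrightarrow> G \<in> \<Delta>"
    and vertex_face: "i \<in> V \<Longrightarrow> {i} \<in> \<Delta>"
    and card_facet: "F \<in> facets \<Delta> \<Longrightarrow> card F = 3"
    and facets_nonempty: "facets \<Delta> \<noteq> {}"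
begin

abbreviation thick_at :: "(nat \<Rightarrow> nat) \<Rightarrow> nat \<Rightarrow> bool" where
  "thick_at a m \<equiv> thick (facets \<Delta>) V a m"

abbreviation nonface :: "nat set \<Rightarrow> bool" where
  "nonface N \<equiv> N \<subseteq> V \<and> N \<notin> \<Delta>"

lemma facetD: "F \<in> facets \<Delta> \<Longrightarrow> F \<in> \<Delta>" "F \<in> facets \<Delta> \<Longrightarrow> F \<subseteq> V"
  using faces_subset by (auto simp: facets_def)

lemma finite_subset_V: "X \<subseteq> V \<Longrightarrow> finite X"
  using finite_V by (rule rev_finite_subset)

lemma face_in_facet:
  assumes "G \<in> \<Delta>"
  shows "\<exists>F\<in>facets \<Delta>. G \<subseteq> F"
proof -
  have "finite \<Delta>" using faces_subset finite_V by (meson finite_Pow_iff finite_subset)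
  from finite_has_maximal2[OF this assms] show ?thesis by (auto simp: facets_def)
qed

lemma card_face: "G \<in> \<Delta> \<Longrightarrow> card G \<le> 3"
  using face_in_facet[of G] card_facet facetD finite_subset_V by (metis card_mono)

lemma card_V: "3 \<le> card V"
  using facets_nonempty card_facet facetD finite_V by (metis card_mono ex_in_conv)

lemma empty_face: "{} \<in> \<Delta>"
  using facets_nonempty facetD face_subset by blast

lemma card_nonface:
  assumes "nonface N"
  shows "2 \<le> card N"
proof (rule ccontr)
  assume "\<not> 2 \<le> card N"
  then have "card N = 0 \<or> card N = 1" by linarith
  then show False
    using assms empty_face vertex_face finite_subset_V[of N] by (auto simp: card_1_singleton_iff)
qed

lemma nonface_diff_facet:
  assumes "nonface N" "F \<in> facets \<Delta>"
  shows "1 \<le> card (N \<inter> (V - F))"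
proof -
  have "N \<inter> (V - F) \<noteq> {}" using assms facetD(1) face_subset by blast
  then show ?thesis using finite_V by (simp add: Suc_le_eq card_gt_0_iff)
qed

lemma sum_of_bool_diff: "(\<Sum>i\<in>V - F. of_bool (i \<in> N)) = card (N \<inter> (V - F))"
  using finite_V by (simp add: Int_commute Int_def)

lemma thick_at_add:
  assumes "thick_at a m" "nonface N"
  shows "thick_at (\<lambda>i. a i + k * of_bool (i \<in> N)) (m + k)"
  unfolding thick_def
proof
  fix F assume F: "F \<in> facets \<Delta>"
  have "k * 1 \<le> k * card (N \<inter> (V - F))"
    using nonface_diff_facet[OF assms(2) F] by (rule mult_le_mono2)
  then show "m + k \<le> (\<Sum>i\<in>V - F. a i + k * of_bool (i \<in> N))"
    using assms(1) F
    by (auto simp: thick_def sum.distrib sum_of_bool_diff simp flip: sum_distrib_left simp del: sum_of_bool_eq intro!: add_mono)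
qed

lemma packs_size:
  assumes "packs \<Delta> V a m" "\<And>N. nonface N \<Longrightarrow> s \<le> card N"
  shows "m * s \<le> (\<Sum>i\<in>V. a i)"
proof -
  obtain Ns where Ns: "set_mset Ns \<subseteq> Pow V - \<Delta>" "size Ns = m" "\<forall>i\<in>V. load Ns i \<le> a i"
    using assms(1) by (auto simp: packs_def)
  have "s \<le> card (N \<inter> V)" if "N \<in># Ns" for N
    using that Ns(1) assms(2)[of N] by (auto simp: Int_absorb2)
  then have "m * s \<le> (\<Sum>i\<in>V. load Ns i)"
    using size_mult_le_sum_mset[of Ns s] Ns(2) finite_V by (simp add: sum_load)
  also have "\<dots> \<le> (\<Sum>i\<in>V. a i)" using Ns(3) by (intro sum_mono) auto
  finally show ?thesis .
qed

text \<open>Extending \<open>G\<close> to a facet only shrinks what is left outside, and zero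
  entries contribute nothing. Applied to faces that miss few points of the support, this bounds
  single exponents from below.\<close>

lemma thick_face:
  assumes "thick_at a t" "G \<in> \<Delta>"
  shows "t \<le> (\<Sum>i\<in>{i \<in> V. 0 < a i} - G. a i)"
proof -
  obtain F where F: "F \<in> facets \<Delta>" "G \<subseteq> F" using face_in_facet[OF assms(2)] by auto
  have "t \<le> (\<Sum>i\<in>V - F. a i)" using assms(1) F(1) by (auto simp: thick_def)
  also have "\<dots> = (\<Sum>i\<in>{i \<in> V. 0 < a i} - F. a i)"
    using finite_V by (intro sum.mono_neutral_right) auto
  also have "\<dots> \<le> (\<Sum>i\<in>{i \<in> V. 0 < a i} - G. a i)"
    using finite_V F(2) by (intro sum_mono2) auto
  finally show ?thesis .
qed

section \<open>The density bound and its consequences\<close>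

lemma packing_density:
  assumes "thick_packs \<Delta> V m" and W: "W \<subseteq> V" "thick_at (\<lambda>i. of_bool (i \<in> W)) r" and r: "1 \<le> r" "r \<le> m"
    and s: "\<And>N. nonface N \<Longrightarrow> s \<le> card N"
  shows "r * s \<le> card W"
proof -
  \<comment> \<open>A face would have thickness 0. So nonfaces exist, and one of least cardinality
    can be chosen.\<close>
  have "W \<notin> \<Delta>"
  proof
    assume "W \<in> \<Delta>"
    moreover have "{i \<in> V. 0 < (of_bool (i \<in> W) :: nat)} - W = {}" by auto
    ultimately have "r \<le> 0" using thick_face[OF W(2), of W] by (simp only: sum.empty)
    then show False using r(1) by simp
  qed
  then obtain N where N: "nonface N" and min: "\<And>N'. nonface N' \<Longrightarrow> card N \<le> card N'"
    using ex_has_least_nat[of nonface W card] W(1) by blast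
  have "thick_at (\<lambda>i. of_bool (i \<in> W) + (m - r) * of_bool (i \<in> N)) m"
    using thick_at_add[OF W(2) N, of "m - r"] r(2) by simp
  then have "packs \<Delta> V (\<lambda>i. of_bool (i \<in> W) + (m - r) * of_bool (i \<in> N)) m"
    using assms(1) by (auto simp: thick_packs_def)
  then have "m * card N \<le> (\<Sum>i\<in>V. of_bool (i \<in> W) + (m - r) * of_bool (i \<in> N))"
    using min by (rule packs_size)
  also have "\<dots> = card W + (m - r) * card N"
    using finite_V N W(1) by (simp add: sum.distrib Int_absorb1 flip: sum_distrib_left)
  finally have "m * card N \<le> card W + (m - r) * card N" .
  \<comment> \<open>The added copies cancel against \<open>m - r\<close> of the \<open>m\<close>
    packed nonfaces, which leaves the bound for \<open>r\<close>.\<close>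
  moreover have "m * card N = r * card N + (m - r) * card N"
    using r(2) by (simp flip: add_mult_distrib)
  ultimately have "r * card N \<le> card W" by linarith
  then show ?thesis using s[OF N] by (meson mult_le_mono2 order_trans)
qed

text \<open>A facet covers at most three points of \<open>W\<close>.\<close>

lemma thick_large:
  assumes "W \<subseteq> V" "r + 3 \<le> card W"
  shows "thick_at (\<lambda>i. of_bool (i \<in> W)) r"
  unfolding thick_def
proof
  fix F assume F: "F \<in> facets \<Delta>"
  have "W \<inter> (V - F) = W - F" using assms(1) by auto
  then show "r \<le> (\<Sum>i\<in>V - F. of_bool (i \<in> W))"
    unfolding sum_of_bool_diff
    using diff_card_le_card_Diff[of F W] F assms(2) card_facet facetD(2) finite_subset_V by fastforce
qed

text \<open>A face contains at most one of three pairwise non-adjacent vertices, so these would have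
  thickness 2, and the density bound with \<open>s = 2\<close> would read 4 <= 3.\<close>

lemma no_three_nonadjacent:
  assumes tp: "thick_packs \<Delta> V m" "2 \<le> m" and xyz: "{x, y, z} \<subseteq> V" "x \<noteq> y" "x \<noteq> z" "y \<noteq> z"
  shows "{x, y} \<in> \<Delta> \<or> {x, z} \<in> \<Delta> \<or> {y, z} \<in> \<Delta>"
proof (rule ccontr)
  assume *: "\<not> ?thesis"
  have "thick_at (\<lambda>i. of_bool (i \<in> {x, y, z})) 2"
    unfolding thick_def
  proof
    fix F assume "F \<in> facets \<Delta>"
    then have "F \<in> \<Delta>" by (rule facetD)
    then have "\<not> {x, y} \<subseteq> F" "\<not> {x, z} \<subseteq> F" "\<not> {y, z} \<subseteq> F"
      using * face_subset by blast+
    then have "\<exists>p q. p \<noteq> q \<and> {p, q} \<subseteq> {x, y, z} - F" using xyz by blast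
    then obtain p q where pq: "p \<noteq> q" "{p, q} \<subseteq> {x, y, z} \<inter> (V - F)" using xyz(1) by blast
    then have "card {p, q} \<le> card ({x, y, z} \<inter> (V - F))" by (intro card_mono) auto
    then show "2 \<le> (\<Sum>i\<in>V - F. of_bool (i \<in> {x, y, z}) :: nat)"
      unfolding sum_of_bool_diff using pq(1) by simp
  qed
  from packing_density[OF tp(1) xyz(1) this _ tp(2) card_nonface] show False
    using xyz by simp
qed

text \<open>Seven vertices have thickness 4, for which the density bound demands eight.\<close>

lemma card_V_le_6:
  assumes "thick_packs \<Delta> V m" "4 \<le> m"
  shows "card V \<le> 6"
proof (rule ccontr)
  assume "\<not> card V \<le> 6"
  then have "7 \<le> card V" by linarith
  then obtain W where W: "W \<subseteq> V" "card W = 7"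
    using obtain_subset_with_card_n[of 7 V] by blast
  then have "thick_at (\<lambda>i. of_bool (i \<in> W)) 4" by (intro thick_large) auto
  from packing_density[OF assms(1) W(1) this _ assms(2) card_nonface] show False
    using W(2) by simp
qed

text \<open>If every nonface had at least three vertices, five vertices, being of thickness 2, would
  violate the density bound: 6 <= 5.\<close>

lemma exists_nonedge:
  assumes "thick_packs \<Delta> V m" "2 \<le> m" "5 \<le> card V"
  obtains c x where "c \<in> V" "x \<in> V" "c \<noteq> x" "{c, x} \<notin> \<Delta>"
proof -
  have "\<exists>N. nonface N \<and> card N = 2"
  proof (rule ccontr)
    assume "\<nexists>N. nonface N \<and> card N = 2"
    then have *: "3 \<le> card N" if "nonface N" for N
      using card_nonface[OF that] that by (metis le_neq_implies_less Suc_leI eval_nat_numeral(3))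
    obtain W where W: "W \<subseteq> V" "card W = 5"
      using obtain_subset_with_card_n[OF assms(3)] by auto
    then have "thick_at (\<lambda>i. of_bool (i \<in> W)) 2" by (intro thick_large) auto
    from packing_density[OF assms(1) W(1) this _ assms(2) *] show False
      using W(2) by simp
  qed
  then show ?thesis using that by (auto simp: card_2_iff)
qed

text \<open>
  Nonfaces containing the pair \<open>{c, x}\<close> are discarded one by one; if none is left while \<open>k > 0\<close>, counting
  the vertices outside \<open>{c, x}\<close> forces \<open>k = 1\<close> and every nonface to be a pair meeting \<open>{c, x}\<close> once.
\<close>
lemma peel_nonedge:
  assumes e: "c \<in> V" "x \<in> V" "c \<noteq> x" "{c, x} \<notin> \<Delta>" and card: "card V = r + 3"
    and "packs \<Delta> V (\<lambda>i. 1 + k * of_bool (i \<in> {c, x})) (r + k)"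
  shows "packs \<Delta> V (\<lambda>_. 1) r \<or>
    (\<exists>A B. A \<union> B = V - {c, x} \<and> A \<inter> B = {} \<and> card A \<le> 2 \<and> card B \<le> 2 \<and>
       (\<forall>i\<in>A. {c, i} \<notin> \<Delta>) \<and> (\<forall>i\<in>B. {x, i} \<notin> \<Delta>))"
  using assms(6)
proof (induction k)
  case 0
  then show ?case by simp
next
  case (Suc k)
  then obtain Ns where Ns: "set_mset Ns \<subseteq> Pow V - \<Delta>" "size Ns = r + Suc k"
    "\<forall>i\<in>V. load Ns i \<le> 1 + Suc k * of_bool (i \<in> {c, x})"
    by (auto simp: packs_def)
  show ?case
  proof (cases "\<exists>N\<in>#Ns. {c, x} \<subseteq> N")
    case True
    then obtain N Ms where N: "Ns = add_mset N Ms" "{c, x} \<subseteq> N" by (metis insert_DiffM)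
    have "load Ms i \<le> 1 + k * of_bool (i \<in> {c, x})" if "i \<in> V" for i
      using Ns(3)[rule_format, OF that] N by (cases "i \<in> {c, x}") auto
    moreover have "set_mset Ms \<subseteq> Pow V - \<Delta>" "size Ms = r + k" using Ns N(1) by auto
    ultimately have "packs \<Delta> V (\<lambda>i. 1 + k * of_bool (i \<in> {c, x})) (r + k)"
      unfolding packs_def by blast
    then show ?thesis by (rule Suc.IH)
  next
    case False
    define X where "X = V - {c, x}"
    have X: "finite X" "X \<subseteq> V" using finite_V by (auto simp: X_def)
    have cX: "card X = r + 1" using e card finite_V by (simp add: X_def card_Diff_subset)
    have nf: "nonface N" "\<not> {c, x} \<subseteq> N" if "N \<in># Ns" for N using that Ns(1) False by auto
    have meet: "1 \<le> card (N \<inter> X)" if "N \<in># Ns" for N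
    proof -
      have "N \<inter> X \<noteq> {}"
      proof
        assume "N \<inter> X = {}"
        then have "N \<subseteq> {c, x}" using nf[OF that] by (auto simp: X_def)
        then have "N \<subseteq> {c} \<or> N \<subseteq> {x}" using nf(2)[OF that] by auto
        then have "card N \<le> 1" using card_mono[of "{c}" N] card_mono[of "{x}" N] by auto
        then show False using card_nonface[OF nf(1)[OF that]] by linarith
      qed
      then show ?thesis using X(1) by (simp add: Suc_le_eq card_gt_0_iff)
    qed
    have load1: "load Ns i \<le> 1" if "i \<in> X" for i
      using Ns(3)[rule_format, of i] that by (simp add: X_def)
    have le: "size Ns * 1 \<le> (\<Sum>N\<in>#Ns. card (N \<inter> X))" by (rule size_mult_le_sum_mset) (rule meet)
    have le': "(\<Sum>i\<in>X. load Ns i) \<le> (\<Sum>i\<in>X. 1)" using load1 by (rule sum_mono)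
    \<comment> \<open>The number of nonfaces is \<open>r + Suc k\<close>, and the load on
      \<open>X\<close> is at most \<open>r + 1\<close>. This forces \<open>k = 0\<close> and turns
      both estimates into equalities.\<close>
    have k: "k = 0" and tot: "(\<Sum>N\<in>#Ns. card (N \<inter> X)) \<le> size Ns"
      and tot': "(\<Sum>i\<in>X. load Ns i) = (\<Sum>i\<in>X. 1)"
      using le le' unfolding Ns(2) sum_load[OF X(1), of Ns] by (simp_all add: cX)
    have load_eq: "load Ns i = 1" if "i \<in> X" for i
      using sum_mono_inv[OF tot' load1 that X(1)] .
    have shape: "N = {c, i} \<or> N = {x, i}" if N: "N \<in># Ns" and i: "i \<in> N" "i \<in> X" for N i
    proof -
      have "card (N \<inter> X) = 1" using sum_mset_tight[of Ns "\<lambda>N. card (N \<inter> X)", OF meet tot N] .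
      then obtain j where "N \<inter> X = {j}" by (auto simp: card_1_singleton_iff)
      then have "N \<inter> X = {i}" using i by (metis IntI singletonD)
      then have sub: "N \<subseteq> {c, x, i}" using nf[OF N] by (auto simp: X_def)
      have "c \<in> N \<or> x \<in> N"
      proof (rule ccontr)
        assume "\<not> ?thesis"
        then have "N = {i}" using sub i by auto
        then show False using card_nonface[OF nf(1)[OF N]] by simp
      qed
      then show ?thesis using sub nf(2)[OF N] i by blast
    qed
    \<comment> \<open>A member of \<open>Ns\<close> joins each vertex of \<open>X\<close> to
      \<open>c\<close> or to \<open>x\<close>, and not to both, since its load is 1. As
      \<open>k = 0\<close>, the loads of \<open>c\<close> and \<open>x\<close> are at most 2, which
      bounds both sides.\<close>
    define A where "A = {i \<in> X. {c, i} \<in># Ns}"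
    define B where "B = {i \<in> X. {x, i} \<in># Ns}"
    have un: "A \<union> B = X"
    proof -
      have "i \<in> A \<union> B" if "i \<in> X" for i
      proof -
        have "load Ns i \<noteq> 0" using load_eq[OF that] by simp
        then obtain N where N: "N \<in># Ns" "i \<in> N" by (auto simp: load_eq_0_iff)
        then show ?thesis using shape[OF N that] that by (auto simp: A_def B_def)
      qed
      then show ?thesis by (auto simp: A_def B_def)
    qed
    have disj: "A \<inter> B = {}"
    proof (rule ccontr)
      assume "A \<inter> B \<noteq> {}"
      then obtain i where i: "i \<in> X" "{c, i} \<in># Ns" "{x, i} \<in># Ns" by (auto simp: A_def B_def)
      have "card {{c, i}, {x, i}} \<le> load Ns i" by (rule card_le_load) (use i in auto)
      moreover have "{c, i} \<noteq> {x, i}" using e(3) i(1) by (auto simp: X_def doubleton_eq_iff)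
      ultimately show False using load_eq[OF i(1)] by simp
    qed
    have le2: "card {i \<in> X. {v, i} \<in># Ns} \<le> 2" if "v \<in> {c, x}" for v
    proof -
      have "inj_on (\<lambda>i. {v, i}) X" by (auto simp: inj_on_def doubleton_eq_iff)
      then have "inj_on (\<lambda>i. {v, i}) {i \<in> X. {v, i} \<in># Ns}" by (rule inj_on_subset) auto
      then have "card {i \<in> X. {v, i} \<in># Ns} = card ((\<lambda>i. {v, i}) ` {i \<in> X. {v, i} \<in># Ns})"
        by (simp add: card_image)
      also have "\<dots> \<le> load Ns v" by (rule card_le_load) auto
      also have "\<dots> \<le> 2" using Ns(3)[rule_format, of v] k that e(1,2) by auto
      finally show ?thesis .
    qed
    have nonadj: "\<forall>i\<in>A. {c, i} \<notin> \<Delta>" "\<forall>i\<in>B. {x, i} \<notin> \<Delta>"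
      using nf(1) by (auto simp: A_def B_def)
    have cards: "card A \<le> 2" "card B \<le> 2" unfolding A_def B_def by (rule le2, simp)+
    show ?thesis
      unfolding X_def[symmetric]
      by (intro disjI2 exI[of _ A] exI[of _ B] conjI un disj nonadj cards)
  qed
qed

text \<open>The all-ones exponent has thickness \<open>r\<close>; copies of the nonedge raise it to
  \<open>m\<close>, where a packing is available, and \<open>peel_nonedge\<close> takes them away
  again. As \<open>r <= 3 <= m\<close>, the subtraction \<open>m - r\<close> is exact.\<close>

lemma packs_ones_or_double_star:
  assumes tp: "thick_packs \<Delta> V m" "3 \<le> m" and card: "card V = r + 3" "r \<le> 3"
    and e: "c \<in> V" "x \<in> V" "c \<noteq> x" "{c, x} \<notin> \<Delta>"
  shows "packs \<Delta> V (\<lambda>_. 1) r \<or>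
    (\<exists>A B. A \<union> B = V - {c, x} \<and> A \<inter> B = {} \<and> card A \<le> 2 \<and> card B \<le> 2 \<and>
       (\<forall>i\<in>A. {c, i} \<notin> \<Delta>) \<and> (\<forall>i\<in>B. {x, i} \<notin> \<Delta>))"
proof -
  have "thick_at (\<lambda>i. of_bool (i \<in> V)) r" using card by (intro thick_large) auto
  then have "thick_at (\<lambda>_. 1) r" by (simp add: thick_def)
  from thick_at_add[OF this, of "{c, x}" "m - r"] e
  have "thick_at (\<lambda>i. 1 + (m - r) * of_bool (i \<in> {c, x})) (r + (m - r))" by blast
  moreover have "r + (m - r) = m" using tp(2) card(2) by simp
  ultimately have "packs \<Delta> V (\<lambda>i. 1 + (m - r) * of_bool (i \<in> {c, x})) (r + (m - r))"
    using tp(1) by (metis thick_packs_def)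
  then show ?thesis by (rule peel_nonedge[OF e card(1)])
qed

section \<open>Disjoint nonfaces on at most six vertices\<close>

lemma packs_ones_2:
  assumes "nonface M" "nonface N" "M \<inter> N = {}"
  shows "packs \<Delta> V (\<lambda>_. 1) 2"
  unfolding packs_def using assms by (intro exI[of _ "{#M, N#}"]) auto

lemma packs_ones_3:
  assumes "nonface L" "nonface M" "nonface N" "L \<inter> M = {}" "L \<inter> N = {}" "M \<inter> N = {}"
  shows "packs \<Delta> V (\<lambda>_. 1) 3"
  unfolding packs_def using assms by (intro exI[of _ "{#L, M, N#}"]) auto

lemma packs_ones:
  assumes tp: "thick_packs \<Delta> V m" "3 \<le> m" and "card V \<le> 6"
  shows "packs \<Delta> V (\<lambda>_. 1) (card V - 3)"
proof -
  consider "card V = 3" | "card V = 4" | "card V = 5" | "card V = 6"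
    using assms(3) card_V by linarith
  then show ?thesis
  proof cases
    case 1
    then show ?thesis by (auto simp: packs_def intro!: exI[of _ "{#}"])
  next
    case 2
    then have "V \<notin> \<Delta>" using card_face[of V] by auto
    then show ?thesis using 2 by (auto simp: packs_def intro!: exI[of _ "{#V#}"])
  next
    case 3
    obtain c x where e: "c \<in> V" "x \<in> V" "c \<noteq> x" "{c, x} \<notin> \<Delta>"
      using exists_nonedge[OF tp(1)] tp(2) 3 by auto
    show ?thesis
    proof (rule ccontr)
      assume *: "\<not> ?thesis"
      then obtain A B where AB: "A \<union> B = V - {c, x}" "A \<inter> B = {}" "card A \<le> 2" "card B \<le> 2"
        "\<forall>i\<in>A. {c, i} \<notin> \<Delta>" "\<forall>i\<in>B. {x, i} \<notin> \<Delta>"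
        using packs_ones_or_double_star[OF tp, of 2, OF _ _ e] 3 by auto
      \<comment> \<open>Three vertices are split into two sides of size at most two, so both sides
        are inhabited; one leaf from each gives two disjoint nonedges.\<close>
      have "card (A \<union> B) = 3" unfolding AB(1) using e 3 finite_V by (simp add: card_Diff_subset)
      then have "A \<noteq> {}" "B \<noteq> {}" using AB(3,4) by auto
      then obtain i j where ij: "i \<in> A" "j \<in> B" by auto
      then have "c \<noteq> i" "c \<noteq> j" "x \<noteq> i" "x \<noteq> j" "i \<noteq> j" "i \<in> V" "j \<in> V" using AB(1,2) by auto
      then have "packs \<Delta> V (\<lambda>_. 1) 2"
        using e ij AB(5,6) by (intro packs_ones_2[of "{c, i}" "{x, j}"]) auto
      then show False using * 3 by simp
    qed
  next
    case 4
    obtain c x where e: "c \<in> V" "x \<in> V" "c \<noteq> x" "{c, x} \<notin> \<Delta>"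
      using exists_nonedge[OF tp(1)] tp(2) 4 by auto
    show ?thesis
    proof (rule ccontr)
      assume *: "\<not> ?thesis"
      \<comment> \<open>Applied to \<open>{c, x}\<close> and then to \<open>{c, u}\<close> with \<open>u\<close> a leaf at \<open>c\<close>, this yields a perfect matching.\<close>
      have split: "\<exists>A B. A \<union> B = V - {c, x} \<and> A \<inter> B = {} \<and> card A = 2 \<and> card B = 2 \<and>
          (\<forall>i\<in>A. {c, i} \<notin> \<Delta>) \<and> (\<forall>i\<in>B. {x, i} \<notin> \<Delta>)"
        if e: "c \<in> V" "x \<in> V" "c \<noteq> x" "{c, x} \<notin> \<Delta>" for c x
      proof -
        obtain A B where AB: "A \<union> B = V - {c, x}" "A \<inter> B = {}" "card A \<le> 2" "card B \<le> 2"
          "\<forall>i\<in>A. {c, i} \<notin> \<Delta>" "\<forall>i\<in>B. {x, i} \<notin> \<Delta>"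
          using packs_ones_or_double_star[OF tp, of 3, OF _ _ e] * 4 by auto
        have "finite (A \<union> B)" unfolding AB(1) using finite_V by simp
        moreover have "card (A \<union> B) = 4" unfolding AB(1) using e 4 finite_V by (simp add: card_Diff_subset)
        ultimately have "card A + card B = 4" using AB(2) by (simp add: card_Un_disjoint)
        then have "card A = 2" "card B = 2" using AB(3,4) by auto
        then show ?thesis using AB by blast
      qed
      obtain A B where AB: "A \<union> B = V - {c, x}" "A \<inter> B = {}" "card A = 2" "card B = 2"
        "\<forall>i\<in>A. {c, i} \<notin> \<Delta>" "\<forall>i\<in>B. {x, i} \<notin> \<Delta>"
        using split[OF e] by blast
      obtain u v where uv: "A = {u, v}" "u \<noteq> v" using AB(3) by (auto simp: card_2_iff)
      obtain w z where wz: "B = {w, z}" "w \<noteq> z" using AB(4) by (auto simp: card_2_iff)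
      have mem: "u \<in> V - {c, x}" "v \<in> V - {c, x}" "w \<in> V - {c, x}" "z \<in> V - {c, x}"
        unfolding AB(1)[symmetric] uv(1) wz(1) by simp_all
      have dist: "u \<noteq> w" "u \<noteq> z" "v \<noteq> w" "v \<noteq> z" using AB(2) unfolding uv(1) wz(1) by auto
      have cu: "{c, u} \<notin> \<Delta>" "{c, v} \<notin> \<Delta>" "{x, w} \<notin> \<Delta>" "{x, z} \<notin> \<Delta>"
        using AB(5,6) unfolding uv(1) wz(1) by simp_all
      obtain A' B' where AB': "A' \<union> B' = V - {c, u}" "A' \<inter> B' = {}" "card A' = 2" "card B' = 2"
        "\<forall>i\<in>B'. {u, i} \<notin> \<Delta>"
        using split[of c u] mem e(1) cu(1) by blast
      \<comment> \<open>If \<open>v\<close> or \<open>x\<close> were in \<open>B'\<close>, it would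
        form with \<open>c\<close> and \<open>u\<close> three pairwise non-adjacent vertices. So
        both fill \<open>A'\<close>, \<open>w\<close> falls into \<open>B'\<close>, and
        \<open>{c, v}\<close>, \<open>{u, w}\<close>, \<open>{x, z}\<close> is the matching.\<close>
      have "v \<notin> B'"
        using no_three_nonadjacent[OF tp(1), of c u v] tp(2) mem e(1) uv(2) cu(1,2) AB'(5) by auto
      moreover have "x \<notin> B'"
        using no_three_nonadjacent[OF tp(1), of c u x] tp(2) mem e cu(1) AB'(5) by auto
      moreover have "v \<in> V - {c, u}" "x \<in> V - {c, u}" "w \<in> V - {c, u}" using mem e uv(2) dist by auto
      ultimately have sub: "{v, x} \<subseteq> A'" and w: "w \<in> A' \<union> B'" unfolding AB'(1)[symmetric] by auto
      have "finite A'" using AB'(3) card.infinite by fastforce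
      moreover have "card {v, x} = 2" using mem by auto
      ultimately have "{v, x} = A'" using sub AB'(3) by (intro card_subset_eq) auto
      then have "w \<in> B'" using w mem dist by auto
      then have "{u, w} \<notin> \<Delta>" using AB'(5) by auto
      then have "packs \<Delta> V (\<lambda>_. 1) 3"
        using mem dist uv(2) wz(2) e cu
        by (intro packs_ones_3[of "{c, v}" "{u, w}" "{x, z}"]) auto
      then show False using * 4 by simp
    qed
  qed
qed

section \<open>Reduction to exponents supported on three vertices\<close>

text \<open>The face \<open>{p, r}\<close> forces \<open>t <= a q\<close>. If \<open>{p, q}\<close>
  is a face, it forces \<open>t <= a r\<close>, and copies of \<open>{q, r}\<close> suffice;
  otherwise both nonedges meet in \<open>q\<close>, and the face \<open>{q}\<close> gives
  \<open>t <= a p + a r\<close>.\<close>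

lemma packs_path:
  assumes S: "{i \<in> V. 0 < a i} = {p, q, r}" "p \<noteq> q" "p \<noteq> r" "q \<noteq> r"
    and qr: "{q, r} \<notin> \<Delta>" "{p, r} \<in> \<Delta>" and t: "thick_at a t"
  shows "packs \<Delta> V a t"
proof -
  have V: "p \<in> V" "q \<in> V" "r \<in> V" using S(1) by auto
  have "{p, q, r} - {p, r} = {q}" using S by auto
  then have tq: "t \<le> a q" using thick_face[OF t qr(2)] S(1) by simp
  show ?thesis
  proof (cases "{p, q} \<in> \<Delta>")
    case True
    have "{p, q, r} - {p, q} = {r}" using S by auto
    then have "t \<le> a r" using thick_face[OF t True] S(1) by simp
    then show ?thesis
      unfolding packs_def using tq V qr(1)
      by (intro exI[of _ "replicate_mset t {q, r}"]) (auto simp: load_replicate_mset)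
  next
    case False
    have "{p, q, r} - {q} = {p, r}" using S by auto
    then have "t \<le> a p + a r" using thick_face[OF t vertex_face[OF V(2)]] S by simp
    then show ?thesis
      unfolding packs_def using tq V qr(1) False S
      \<comment> \<open>Copies of \<open>{q, r}\<close> are taken as far as \<open>a r\<close>
        permits, and \<open>{p, q}\<close> fills the rest.\<close>
      by (intro exI[of _ "replicate_mset (min t (a r)) {q, r} + replicate_mset (t - min t (a r)) {p, q}"])
        (auto simp: load_replicate_mset load_plus)
  qed
qed

text \<open>If the support \<open>S\<close> is a face, then \<open>t = 0\<close>; if it is a minimal
  nonface, \<open>t\<close> copies of \<open>S\<close> work. Otherwise \<open>S\<close> is a nonedge
  plus a vertex \<open>p\<close>, which \<open>no3\<close> makes adjacent to an end of the nonedge,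
  so \<open>packs_path\<close> applies.\<close>

lemma packs_small_support:
  assumes no3: "\<And>x y z. {x, y, z} \<subseteq> V \<Longrightarrow> x \<noteq> y \<Longrightarrow> x \<noteq> z \<Longrightarrow> y \<noteq> z \<Longrightarrow>
      {x, y} \<in> \<Delta> \<or> {x, z} \<in> \<Delta> \<or> {y, z} \<in> \<Delta>"
    and card: "card {i \<in> V. 0 < a i} \<le> 3" and t: "thick_at a t"
  shows "packs \<Delta> V a t"
proof -
  define S where "S = {i \<in> V. 0 < a i}"
  have S: "S \<subseteq> V" "finite S" using finite_V by (auto simp: S_def)
  consider "S \<in> \<Delta>" | "S \<notin> \<Delta>" "\<forall>i\<in>S. S - {i} \<in> \<Delta>" | p where "p \<in> S" "S - {p} \<notin> \<Delta>" by blast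
  then show ?thesis
  proof cases
    case 1
    then have "t = 0" using thick_face[OF t, of S] by (simp add: S_def)
    then show ?thesis by (auto simp: packs_def intro!: exI[of _ "{#}"])
  next
    case 2
    have "t \<le> a i" if "i \<in> S" for i
    proof -
      have "S - (S - {i}) = {i}" using that by auto
      then show ?thesis using thick_face[OF t, of "S - {i}"] 2(2) that by (simp add: S_def)
    qed
    then show ?thesis
      unfolding packs_def using 2(1) S
      by (intro exI[of _ "replicate_mset t S"]) (auto simp: load_replicate_mset)
  next
    case 3
    have "nonface (S - {p})" using 3 S by auto
    from card_nonface[OF this] have "card (S - {p}) = 2" using card 3 S by (simp add: S_def)
    then obtain q r where qr: "S - {p} = {q, r}" "q \<noteq> r" by (auto simp: card_2_iff)
    then have dist: "p \<noteq> q" "p \<noteq> r" and Spqr: "S = {p, q, r}" using 3(1) by auto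
    have "{p, q} \<in> \<Delta> \<or> {p, r} \<in> \<Delta>"
      using no3[of p q r] qr dist Spqr S(1) 3(2) by auto
    then show ?thesis
    proof
      assume "{p, q} \<in> \<Delta>"
      then show ?thesis
        using packs_path[of a p r q t] Spqr qr dist 3(2) t by (auto simp: S_def insert_commute)
    next
      assume "{p, r} \<in> \<Delta>"
      then show ?thesis
        using packs_path[of a p q r t] Spqr qr dist 3(2) t by (auto simp: S_def)
    qed
  qed
qed

lemma thick_packs_if_packs_ones:
  assumes no3: "\<And>x y z. {x, y, z} \<subseteq> V \<Longrightarrow> x \<noteq> y \<Longrightarrow> x \<noteq> z \<Longrightarrow> y \<noteq> z \<Longrightarrow>
      {x, y} \<in> \<Delta> \<or> {x, z} \<in> \<Delta> \<or> {y, z} \<in> \<Delta>"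
    and "packs \<Delta> V (\<lambda>_. 1) (card V - 3)"
  shows "thick_packs \<Delta> V t"
proof -
  obtain Ns where Ns: "set_mset Ns \<subseteq> Pow V - \<Delta>" "size Ns = card V - 3" "\<forall>i\<in>V. load Ns i \<le> 1"
    using assms(2) by (auto simp: packs_def)
  have meet_le: "(\<Sum>N\<in>#Ns. card (N \<inter> X)) \<le> card X" if "X \<subseteq> V" for X
  proof -
    have "(\<Sum>i\<in>X. load Ns i) \<le> (\<Sum>i\<in>X. 1)" using that Ns(3) by (intro sum_mono) auto
    then show ?thesis using sum_load[OF finite_subset_V[OF that]] by simp
  qed
  \<comment> \<open>The members are disjoint, each meets \<open>V - F\<close>, and
    \<open>V - F\<close> has exactly as many vertices as there are members.\<close>
  have tight: "card (N \<inter> (V - F)) = 1" if N: "N \<in># Ns" and F: "F \<in> facets \<Delta>" for N F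
  proof (rule sum_mset_tight[where f = "\<lambda>N. card (N \<inter> (V - F))", OF _ _ N])
    show "1 \<le> card (N \<inter> (V - F))" if "N \<in># Ns" for N
      using nonface_diff_facet[OF _ F] that Ns(1) by auto
    have "card (V - F) = size Ns"
      using Ns(2) F card_facet facetD finite_subset_V by (simp add: card_Diff_subset)
    then show "(\<Sum>N\<in>#Ns. card (N \<inter> (V - F))) \<le> size Ns" using meet_le[of "V - F"] by auto
  qed
  have "thick_at a t \<Longrightarrow> packs \<Delta> V a t" for a
  proof (induction t arbitrary: a)
    case 0
    then show ?case by (auto simp: packs_def intro!: exI[of _ "{#}"])
  next
    case (Suc t)
    define S where "S = {i \<in> V. 0 < a i}"
    show ?case
    proof (cases "\<exists>N\<in>#Ns. N \<subseteq> S")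
      case True
      then obtain N where N: "N \<in># Ns" "N \<subseteq> S" by auto
      \<comment> \<open>The truncated subtraction is exact because \<open>N\<close> lies in the
        support; by \<open>tight\<close> it costs exactly one unit of thickness.\<close>
      define b where "b = (\<lambda>i. a i - of_bool (i \<in> N))"
      have a: "a i = b i + of_bool (i \<in> N)" for i using N(2) by (auto simp: b_def S_def)
      have "t \<le> (\<Sum>i\<in>V - F. b i)" if F: "F \<in> facets \<Delta>" for F
      proof -
        have "Suc t \<le> (\<Sum>i\<in>V - F. b i + of_bool (i \<in> N))"
          using Suc.prems F unfolding thick_def a[symmetric] by blast
        also have "\<dots> = (\<Sum>i\<in>V - F. b i) + 1"
          using tight[OF N(1) F] by (simp add: sum.distrib sum_of_bool_diff del: sum_of_bool_eq)
        finally show ?thesis by simp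
      qed
      then have "packs \<Delta> V b t" by (intro Suc.IH) (simp add: thick_def)
      then obtain Ms where Ms: "set_mset Ms \<subseteq> Pow V - \<Delta>" "size Ms = t" "\<forall>i\<in>V. load Ms i \<le> b i"
        by (auto simp: packs_def)
      then show ?thesis
        unfolding packs_def a using Ns(1) N(1)
        by (intro exI[of _ "add_mset N Ms"]) auto
    next
      case False
      \<comment> \<open>Now \<open>card V - 3\<close> disjoint members each need a vertex outside
        \<open>S\<close>, which leaves at most three vertices for \<open>S\<close>.\<close>
      have "1 \<le> card (N \<inter> (V - S))" if "N \<in># Ns" for N
      proof -
        have "N \<inter> (V - S) \<noteq> {}" using that False Ns(1) by auto
        then show ?thesis using finite_V by (simp add: Suc_le_eq card_gt_0_iff)
      qed
      then have "size Ns * 1 \<le> (\<Sum>N\<in>#Ns. card (N \<inter> (V - S)))" by (rule size_mult_le_sum_mset)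
      also have "\<dots> \<le> card (V - S)" by (rule meet_le) auto
      also have "\<dots> = card V - card S" using finite_V by (intro card_Diff_subset) (auto simp: S_def)
      finally have "card V - 3 \<le> card V - card S" using Ns(2) by simp
      moreover have "card S \<le> card V" using finite_V by (intro card_mono) (auto simp: S_def)
      ultimately have "card S \<le> 3" using card_V by linarith
      then show ?thesis using packs_small_support[OF no3 _ Suc.prems] by (simp add: S_def)
    qed
  qed
  then show ?thesis by (simp add: thick_packs_def)
qed

lemma thick_packs_all:
  assumes "thick_packs \<Delta> V m" "3 \<le> m" "card V \<le> 6"
  shows "thick_packs \<Delta> V t"
  using no_three_nonadjacent[OF assms(1)] packs_ones[OF assms] assms(2)
  by (intro thick_packs_if_packs_ones) auto

section \<open>From the third power to the lower ones\<close>

text \<open>The support of an exponent of thickness 1 is not a face, so it is itself the required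
  nonface.\<close>

lemma thick_packs_1: "thick_packs \<Delta> V 1"
  unfolding thick_packs_def
proof (intro allI impI)
  fix a assume a: "thick_at a 1"
  define S where "S = {i \<in> V. 0 < a i}"
  have "S \<notin> \<Delta>" using thick_face[OF a, of S] by (auto simp: S_def)
  then show "packs \<Delta> V a 1"
    unfolding packs_def by (intro exI[of _ "{#S#}"]) (auto simp: S_def)
qed

text \<open>Two further vertices complete a 4-subset to a six-set of thickness 3. Three disjoint
  nonfaces in it must be pairs, and one of them avoids the two added vertices.\<close>

lemma nonedge_in_4_set:
  assumes tp: "thick_packs \<Delta> V 3" and "6 \<le> card V" and S: "S \<subseteq> V" "4 \<le> card S"
  shows "\<exists>c x. {c, x} \<subseteq> S \<and> c \<noteq> x \<and> {c, x} \<notin> \<Delta>"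
proof -
  obtain T where T: "T \<subseteq> S" "card T = 4" using obtain_subset_with_card_n[OF S(2)] by auto
  have "finite T" using T S finite_subset_V by blast
  have "2 \<le> card (V - T)"
    using assms(2) T S(1) \<open>finite T\<close> by (subst card_Diff_subset) auto
  then obtain Y where Y: "Y \<subseteq> V - T" "card Y = 2" using obtain_subset_with_card_n by metis
  have W: "T \<union> Y \<subseteq> V" "finite Y" "finite (T \<union> Y)"
    using T S(1) Y finite_subset_V by blast+
  have cW: "card (T \<union> Y) = 6"
    using T Y W \<open>finite T\<close> by (subst card_Un_disjoint) auto
  have "thick_at (\<lambda>i. of_bool (i \<in> T \<union> Y)) 3" using W(1) cW by (intro thick_large) auto
  then have "packs \<Delta> V (\<lambda>i. of_bool (i \<in> T \<union> Y)) 3" using tp by (auto simp: thick_packs_def)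
  then obtain Ns where Ns: "set_mset Ns \<subseteq> Pow V - \<Delta>" "size Ns = 3" "\<forall>i\<in>V. load Ns i \<le> of_bool (i \<in> T \<union> Y)"
    by (auto simp: packs_def)
  have load1: "load Ns i \<le> 1" if "i \<in> V" for i
    using Ns(3)[rule_format, OF that] of_bool_less_eq_one by (rule order_trans)
  have "\<exists>N\<in>#Ns. N \<inter> Y = {}"
  proof (rule ccontr)
    assume "\<not> ?thesis"
    then have "1 \<le> card (N \<inter> Y)" if "N \<in># Ns" for N
      using that W(2) by (auto simp: Suc_le_eq card_gt_0_iff)
    then have "size Ns * 1 \<le> (\<Sum>N\<in>#Ns. card (N \<inter> Y))" by (rule size_mult_le_sum_mset)
    also have "\<dots> = (\<Sum>i\<in>Y. load Ns i)" using W(2) by (simp add: sum_load)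
    also have "\<dots> \<le> (\<Sum>i\<in>Y. 1)" using load1 W(1) by (intro sum_mono) auto
    finally show False using Ns(2) Y(2) by simp
  qed
  then obtain N where N: "N \<in># Ns" "N \<inter> Y = {}" by auto
  have NT: "M \<subseteq> T \<union> Y" if M: "M \<in># Ns" for M
  proof
    fix i assume i: "i \<in> M"
    then have "load Ns i \<noteq> 0" using M by (auto simp: load_eq_0_iff)
    moreover have "load Ns i \<le> of_bool (i \<in> T \<union> Y)" using Ns(1,3) M i by blast
    ultimately show "i \<in> T \<union> Y" by (cases "i \<in> T \<union> Y") simp_all
  qed
  \<comment> \<open>The other two members take up at least four of the six vertices.\<close>
  have "card N = 2"
  proof -
    obtain Ms where Ms: "Ns = add_mset N Ms" using N(1) by (metis insert_DiffM)
    have "2 \<le> card (M \<inter> (T \<union> Y))" if "M \<in># Ns" for M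
      using card_nonface[of M] that Ns(1) NT[OF that] by (auto simp: Int_absorb2)
    then have "size Ms * 2 \<le> (\<Sum>M\<in>#Ms. card (M \<inter> (T \<union> Y)))"
      using Ms by (intro size_mult_le_sum_mset) auto
    moreover have "(\<Sum>M\<in>#Ns. card (M \<inter> (T \<union> Y))) \<le> card (T \<union> Y)"
    proof -
      have "(\<Sum>i\<in>T \<union> Y. load Ns i) \<le> (\<Sum>i\<in>T \<union> Y. 1)"
        using load1 W(1) by (intro sum_mono) auto
      then show ?thesis using sum_load[OF W(3), of Ns] by simp
    qed
    moreover have "card (N \<inter> (T \<union> Y)) = card N" using NT[OF N(1)] by (simp add: Int_absorb2)
    moreover have "2 \<le> card N" using card_nonface[of N] N(1) Ns(1) by auto
    ultimately show ?thesis using Ms Ns(2) cW by simp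
  qed
  then obtain c x where "N = {c, x}" "c \<noteq> x" by (auto simp: card_2_iff)
  moreover have "N \<subseteq> S" using NT[OF N(1)] N(2) T(1) by auto
  ultimately show ?thesis using N(1) Ns(1) by blast
qed

lemma thick_packs_2:
  assumes tp: "thick_packs \<Delta> V 3" and card: "6 \<le> card V"
  shows "thick_packs \<Delta> V 2"
  unfolding thick_packs_def
proof (intro allI impI)
  fix a assume a: "thick_at a 2"
  define S where "S = {i \<in> V. 0 < a i}"
  have SV: "S \<subseteq> V" by (auto simp: S_def)
  show "packs \<Delta> V a 2"
  proof (cases "\<exists>c x. {c, x} \<subseteq> S \<and> c \<noteq> x \<and> {c, x} \<notin> \<Delta>")
    case False
    then have "card S \<le> 3" using nonedge_in_4_set[OF tp card SV] by fastforce
    then show ?thesis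
      using no_three_nonadjacent[OF tp] a by (intro packs_small_support) (auto simp: S_def)
  next
    case True
    then obtain c x where e: "c \<in> V" "x \<in> V" "c \<noteq> x" "{c, x} \<notin> \<Delta>"
      "0 < a c" "0 < a x" by (auto simp: S_def)
    have "thick_at (\<lambda>i. a i + 1 * of_bool (i \<in> {c, x})) (2 + 1)"
      using e by (intro thick_at_add[OF a]) auto
    then have "packs \<Delta> V (\<lambda>i. a i + of_bool (i \<in> {c, x})) 3"
      using tp by (simp add: thick_packs_def)
    then obtain Ns where Ns: "set_mset Ns \<subseteq> Pow V - \<Delta>" "size Ns = 3"
      "\<forall>i\<in>V. load Ns i \<le> a i + of_bool (i \<in> {c, x})"
      by (auto simp: packs_def)
    \<comment> \<open>The nonface to discard must contain whichever of \<open>c\<close> and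
      \<open>x\<close> is loaded beyond \<open>a\<close>. If there were none, both would be
      overloaded, hence of load at least 2, while no member contains both: that takes four members,
      not three.\<close>
    have "\<exists>N\<in>#Ns. (load Ns c \<le> a c \<or> c \<in> N) \<and> (load Ns x \<le> a x \<or> x \<in> N)"
    proof (rule ccontr)
      assume *: "\<not> ?thesis"
      obtain N where N: "N \<in># Ns" using Ns(2) by fastforce
      have "load Ns c = 0 \<Longrightarrow> load Ns c \<le> a c" "load Ns x = 0 \<Longrightarrow> load Ns x \<le> a x" by auto
      then have "a c < load Ns c" "a x < load Ns x"
        using * N by (metis load_eq_0_iff not_le)+
      moreover have "load Ns c + load Ns x \<le> size Ns"
      proof -
        have "\<not> (c \<in> N \<and> x \<in> N)" if "N \<in># Ns" for N using * that by blast
        then show ?thesis by (induction Ns) (auto simp: of_bool_def)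
      qed
      ultimately show False using Ns(2) e(5,6) by linarith
    qed
    then obtain N Ms where N: "Ns = add_mset N Ms" "load Ns c \<le> a c \<or> c \<in> N" "load Ns x \<le> a x \<or> x \<in> N"
      by (metis insert_DiffM)
    have "load Ms i \<le> a i" if "i \<in> V" for i
      using Ns(3)[rule_format, OF that] N by (cases "i = c \<or> i = x") auto
    moreover have "set_mset Ms \<subseteq> Pow V - \<Delta>" "size Ms = 2" using Ns N(1) by auto
    ultimately show ?thesis unfolding packs_def by blast
  qed
qed

text \<open>On more than six vertices \<open>card_V_le_6\<close> leaves only \<open>m = 3\<close>,
  hence \<open>k\<close> in 1, 2, 3.\<close>

lemma thick_packs_down:
  assumes "thick_packs \<Delta> V m" "3 \<le> m" "1 \<le> k" "k \<le> m"
  shows "thick_packs \<Delta> V k"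
proof (cases "card V \<le> 6")
  case True
  then show ?thesis using thick_packs_all assms by blast
next
  case False
  then have "m = 3" using card_V_le_6[OF assms(1)] assms(2) by linarith
  then have "k = 1 \<or> k = 2 \<or> k = m" using assms by linarith
  then show ?thesis using thick_packs_1 thick_packs_2 assms(1) False \<open>m = 3\<close> by auto
qed

end

section \<open>Return to the ideals\<close>

text \<open>As \<open>ne\<close> makes the maximum in \<open>complex_dim\<close> attained, some face
  has three vertices and is a facet by maximality; purity carries its cardinality over to all
  facets.\<close>

lemma two_dim_complex_of_pure:
  assumes sc: "simplicial_complex n \<Delta>" and pure: "pure_complex \<Delta>" and dim: "complex_dim \<Delta> = 2"
    and ne: "\<Delta> \<noteq> {}"
  shows "two_dim_complex {1..n} \<Delta>"
proof -
  have sub: "\<Delta> \<subseteq> Pow {1..n}" and down: "\<And>F G. F \<in> \<Delta> \<Longrightarrow> G \<subseteq> F \<Longrightarrow> G \<in> \<Delta>"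
    and vert: "\<And>i. i \<in> {1..n} \<Longrightarrow> {i} \<in> \<Delta>"
    using sc unfolding simplicial_complex_def by blast+
  have fin: "finite \<Delta>" using sub by (rule finite_subset) simp
  have "Max (face_dim ` \<Delta>) \<in> face_dim ` \<Delta>" using fin ne by (intro Max_in) simp_all
  then obtain F where F: "F \<in> \<Delta>" "face_dim F = 2" using dim unfolding complex_dim_def by force
  have "G = F" if G: "G \<in> \<Delta>" "F \<subseteq> G" for G
  proof -
    have finG: "finite G" using G(1) sub finite_subset[of G "{1..n}"] by blast
    have "face_dim G \<le> Max (face_dim ` \<Delta>)"
      by (rule Max_ge[OF finite_imageI[OF fin] imageI[OF G(1)]])
    then have "face_dim G \<le> face_dim F" using dim F(2) unfolding complex_dim_def by linarith
    then have "card G \<le> card F" by (simp add: face_dim_def)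
    then show ?thesis using card_seteq[OF finG G(2)] by simp
  qed
  then have F_facet: "F \<in> facets \<Delta>" using F(1) unfolding facets_def by blast
  have "card G = 3" if "G \<in> facets \<Delta>" for G
  proof -
    have "face_dim G = face_dim F" using pure that F_facet unfolding pure_complex_def by blast
    then show ?thesis using F(2) by (simp add: face_dim_def)
  qed
  moreover have "facets \<Delta> \<noteq> {}" using F_facet by blast
  ultimately show ?thesis
    using sub down vert by (intro two_dim_complex.intro finite_atLeastAtMost)
qed

theorem corollary2p7:
  fixes n :: nat and \<Delta> :: "nat set set"
  assumes "simplicial_complex n \<Delta>"
    and "pure_complex \<Delta>"
    and "complex_dim \<Delta> = 2"
  shows "(\<forall>m\<ge>3.
            (symbolic_power n \<Delta> m :: 'k::field mpoly set) =
               ideal_power n (stanley_reisner_ideal n \<Delta>) m \<longrightarrow>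
            (\<forall>k. 1 \<le> k \<and> k \<le> m \<longrightarrow>
               (symbolic_power n \<Delta> k :: 'k mpoly set) =
                  ideal_power n (stanley_reisner_ideal n \<Delta>) k)) \<and>
         (\<forall>m\<ge>4.
            (symbolic_power n \<Delta> m :: 'k mpoly set) =
               ideal_power n (stanley_reisner_ideal n \<Delta>) m \<longrightarrow>
            (\<forall>t\<ge>1.
               (symbolic_power n \<Delta> t :: 'k mpoly set) =
                  ideal_power n (stanley_reisner_ideal n \<Delta>) t))"
proof (cases "\<Delta> = {}")
  \<comment> \<open>For \<open>n = 0\<close> the empty family is admissible and its dimension \<open>Max {}\<close> is unspecified; the symbolic
    powers are then the universal set of polynomials in all variables, never an ideal of \<open>poly_ring n\<close>.\<close>
  case True
  have "(pvar (Suc n) :: 'k mpoly) \<notin> ideal_power n (stanley_reisner_ideal n \<Delta>) m" for m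
    unfolding ideal_power_stanley_reisner carrier_poly_ring pvar_def exponents_def by simp
  moreover have "(symbolic_power n \<Delta> m :: 'k mpoly set) = UNIV" for m
    unfolding symbolic_power_def facets_def True by simp
  ultimately have "(symbolic_power n \<Delta> m :: 'k mpoly set) \<noteq> ideal_power n (stanley_reisner_ideal n \<Delta>) m" for m
    by (metis UNIV_I)
  then show ?thesis by simp
next
  case False
  interpret two_dim_complex "{1..n}" \<Delta>
    using assms False by (rule two_dim_complex_of_pure)
  \<comment> \<open>This rewrites both parts into statements about \<open>thick_packs\<close>, in
    which the field no longer occurs.\<close>
  have iff: "(symbolic_power n \<Delta> m :: 'k mpoly set) = ideal_power n (stanley_reisner_ideal n \<Delta>) m
    \<longleftrightarrow> thick_packs \<Delta> {1..n} m" for m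
    using assms(1) facets_nonempty by (rule symbolic_eq_ordinary_iff)
  show ?thesis
    unfolding iff
  proof (intro conjI allI impI)
    fix m k :: nat
    assume "3 \<le> m" "thick_packs \<Delta> {1..n} m" "1 \<le> k \<and> k \<le> m"
    then show "thick_packs \<Delta> {1..n} k" using thick_packs_down by blast
  next
    fix m t :: nat
    assume m: "4 \<le> m" "thick_packs \<Delta> {1..n} m"
    have "3 \<le> m" using m(1) by simp
    from thick_packs_all[OF m(2) this card_V_le_6[OF m(2,1)]] show "thick_packs \<Delta> {1..n} t" .
  qed
qed

end
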